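(* Let $\mathcal{M},\mathcal{N}\in\mathbb{N}$, let $\phi:[0,+\infty)\to(0,1]$ be a non-increasing function, and let $\boldsymbol{L}\in\mathbb{R}^{\mathcal{M}\times\mathcal{N}}$ be a matrix with rows $L_1,\dots,L_{\mathcal{M}}$ such that, for each $i=1,\dots,\mathcal{M}$, the entries $L_{i1},\dots,L_{i\mathcal{N}}$ together with $1$ are linearly independent over $\mathbb{Q}$. Suppose $\boldsymbol{L}$ is $\phi$-multiplicatively badly approximable. Then for all $\boldsymbol{Q}=(Q_1,\dots,Q_{\mathcal{N}})\in[1,+\infty)^{\mathcal{N}}$ with $Q:=(Q_1\cdots Q_{\mathcal{N}})^{1/\mathcal{N}}\geq 2$ we have $$S_{\boldsymbol{L}}(\boldsymbol{Q})\ll_{\mathcal{M},\mathcal{N}} Q^{\mathcal{N}}\log\left(\frac{Q}{\phi(Q)}\right)^{\mathcal{M}}+\frac{Q^{\mathcal{N}}}{\phi(Q)}\log\left(\frac{Q}{\phi(Q)}\right)^{\mathcal{M}-1},$$ where the implied constant depends only on $\mathcal{M}$ and $\mathcal{N}$.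
   Context: For $x\in\mathbb{R}$, $\|x\|$ denotes the distance from $x$ to the nearest integer, and $L_i\boldsymbol{q}:=\sum_{j=1}^{\mathcal{N}}L_{ij}q_j$. The sum of reciprocals of fractional parts is $$S_{\boldsymbol{L}}(\boldsymbol{Q}):=\sum_{\boldsymbol{q}\in\left(\prod_{j=1}^{\mathcal{N}}[-Q_j,Q_j]\cap\mathbb{Z}^{\mathcal{N}}\right)\setminus\{\boldsymbol{0}\}}\ \prod_{i=1}^{\mathcal{M}}\|L_i\boldsymbol{q}\|^{-1}.$$ A matrix $\boldsymbol{L}$ is $\phi$-multiplicatively badly approximable if for all $\boldsymbol{q}\in\mathbb{Z}^{\mathcal{N}}\setminus\{\boldsymbol{0}\}$, $$\prod_{j=1}^{\mathcal{N}}\max\{1,|q_j|\}\prod_{i=1}^{\mathcal{M}}\|L_i\boldsymbol{q}\|\geq\phi\left(\Big(\prod_{j=1}^{\mathcal{N}}\max\{1,|q_j|\}\Big)^{1/\mathcal{N}}\right).$$ A function $\phi$ is non-increasing if $\phi(x)\ge\phi(y)$ whenever $x<y$. The notation $f\ll_{\mathcal{M},\mathcal{N}} g$ means $f\le c\,g$ for a constant $c>0$ depending only on $\mathcal{M},\mathcal{N}$. *)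

theory Defs
  imports "HOL-Analysis.Analysis"
begin

definition dist_nearest_int :: "real \<Rightarrow> real" where
  "dist_nearest_int x = \<bar>x - of_int (round x)\<bar>"

definition lin_form :: "real^'n^'m \<Rightarrow> 'm \<Rightarrow> int^'n \<Rightarrow> real" where
  "lin_form L i q = (\<Sum>j\<in>UNIV. L $ i $ j * of_int (q $ j))"

definition int_box :: "real^'n \<Rightarrow> (int^'n) set" where
  "int_box Q = {q. \<forall>j. \<bar>real_of_int (q $ j)\<bar> \<le> Q $ j} - {0}"

definition S_L :: "real^'n^'m \<Rightarrow> real^'n \<Rightarrow> real" where
  "S_L L Q = (\<Sum>q\<in>int_box Q. \<Prod>i\<in>(UNIV::'m set). inverse (dist_nearest_int (lin_form L i q)))"

definition height_prod :: "int^'n \<Rightarrow> real" where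
  "height_prod q = (\<Prod>j\<in>UNIV. max 1 \<bar>real_of_int (q $ j)\<bar>)"

definition mult_badly_approx :: "(real \<Rightarrow> real) \<Rightarrow> real^'n^'m \<Rightarrow> bool" where
  "mult_badly_approx \<phi> L \<longleftrightarrow>
     (\<forall>q::int^'n. q \<noteq> 0 \<longrightarrow>
        height_prod q * (\<Prod>i\<in>(UNIV::'m set). dist_nearest_int (lin_form L i q))
          \<ge> \<phi> (height_prod q powr (1 / real CARD('n))))"

definition lin_indep_with_one_over_Q :: "real^'n \<Rightarrow> bool" where
  "lin_indep_with_one_over_Q v \<longleftrightarrow>
     (\<forall>(r::'n \<Rightarrow> rat) (r0::rat).
        (\<Sum>j\<in>UNIV. of_rat (r j) * v $ j) + of_rat r0 = 0 \<longrightarrow> r0 = 0 \<and> (\<forall>j. r j = 0))"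

end

theory Submission
  imports Defs
begin

text \<open>
  Let \<open>P = \<Prod> Q\<^sub>j\<close>, \<open>\<delta> = \<phi>(Q)\<close>, \<open>d = M + N\<close>, and sort the vectors of the box dyadically by the
  sizes \<open>h\<^sub>i = 2 ^ (- k\<^sub>i)\<close> of the \<open>\<parallel>L\<^sub>i q\<parallel>\<close>; only products \<open>V = \<Prod> h\<^sub>i \<ge> \<delta> / P\<close> occur. The key estimate is that
  at most \<open>O(PV + (PV/\<delta>) ^ (1 - 1/d))\<close> vectors \<open>q\<close> satisfy \<open>\<parallel>L\<^sub>i q\<parallel> \<le> h\<^sub>i\<close> for all \<open>i\<close>. Consider the real span of
  the corresponding lattice points \<open>(q, Lq + p)\<close>. If it contains \<open>0 \<times> \<real>\<^sup>M\<close>, then every box of shape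
  comparable to \<open>h\<close> in the torus receives a translate of the whole configuration, and comparing with
  the number of all vectors in the box gives \<open>O(PV)\<close>. Otherwise the lattice points lie on a hyperplane.
  By the approximation hypothesis, cells of a suitable relative size \<open>1/R\<close> contain at most one lattice
  point, and a hyperplane meets only a proportion \<open>O(1/R)\<close> of the cells, with
  \<open>R \<ge> (PV/\<delta>) ^ (1/d)\<close>. When summed against \<open>1/V\<close>, the first term gives one logarithm per row, whereas the
  second one is geometric in \<open>V\<close> and saves one logarithm.
\<close>

section \<open>Counting lattice points on a hyperplane\<close>

lemma card_int_interval_le:
  fixes s :: real
  assumes "0 \<le> s"
  shows "finite {k::int. \<bar>real_of_int k\<bar> \<le> s}" "real (card {k::int. \<bar>real_of_int k\<bar> \<le> s}) \<le> 2 * s + 1"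
proof -
  have "{k::int. \<bar>real_of_int k\<bar> \<le> s} = {-\<lfloor>s\<rfloor>..\<lfloor>s\<rfloor>}"
    by (auto simp: abs_le_iff le_floor_iff) (linarith+)
  moreover have "0 \<le> \<lfloor>s\<rfloor>" using assms by simp
  ultimately show "finite {k::int. \<bar>real_of_int k\<bar> \<le> s}"
    "real (card {k::int. \<bar>real_of_int k\<bar> \<le> s}) \<le> 2 * s + 1" by auto
qed

lemma card_int_box_le:
  fixes B :: "'n::finite \<Rightarrow> real"
  assumes "\<And>j. 0 \<le> B j"
  shows "finite {q::int^'n. \<forall>j. \<bar>real_of_int (q $ j)\<bar> \<le> B j}"
    and "real (card {q::int^'n. \<forall>j. \<bar>real_of_int (q $ j)\<bar> \<le> B j}) \<le> (\<Prod>j\<in>UNIV. 2 * B j + 1)"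
proof -
  let ?A = "{q::int^'n. \<forall>j. \<bar>real_of_int (q $ j)\<bar> \<le> B j}"
  let ?P = "PiE UNIV (\<lambda>j. {k::int. \<bar>real_of_int k\<bar> \<le> B j})"
  have inj: "inj_on vec_nth ?A" by (auto simp: inj_on_def vec_nth_inject)
  have sub: "vec_nth ` ?A \<subseteq> ?P" by auto
  have fin: "finite ?P" using card_int_interval_le(1)[OF assms] by (intro finite_PiE) auto
  show "finite ?A" using inj sub fin by (meson finite_imageD finite_subset)
  have "card ?A \<le> card ?P" using inj sub fin by (rule card_inj_on_le)
  then have "real (card ?A) \<le> real (\<Prod>j\<in>UNIV. card {k::int. \<bar>real_of_int k\<bar> \<le> B j})"
    by (simp only: card_PiE finite of_nat_le_iff)
  also have "\<dots> = (\<Prod>j\<in>UNIV. real (card {k::int. \<bar>real_of_int k\<bar> \<le> B j}))" by simp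
  also have "\<dots> \<le> (\<Prod>j\<in>UNIV. 2 * B j + 1)"
    using card_int_interval_le(2)[OF assms] by (intro prod_mono) auto
  finally show "real (card ?A) \<le> (\<Prod>j\<in>UNIV. 2 * B j + 1)" .
qed

text \<open>Fixing the cells of all other coordinates determines the cell of the coordinate \<open>\<iota>\<close> with the
  largest coefficient up to \<open>CARD('k) + 1\<close>, hence its residue modulo \<open>CARD('k) + 2\<close> suffices.\<close>

lemma card_le_of_hyperplane:
  fixes z :: "'a \<Rightarrow> 'k::finite \<Rightarrow> real" and s a :: "'k \<Rightarrow> real"
  assumes s1: "\<And>\<kappa>. 1 \<le> s \<kappa>"
    and z_le: "\<And>x \<kappa>. x \<in> X \<Longrightarrow> \<bar>z x \<kappa>\<bar> \<le> s \<kappa>"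
    and inj: "inj_on (\<lambda>x \<kappa>. \<lfloor>z x \<kappa>\<rfloor>) X"
    and int: "\<And>x \<kappa>. x \<in> X \<Longrightarrow> s \<kappa> \<noteq> R \<Longrightarrow> z x \<kappa> \<in> \<int>"
    and hyp: "\<And>x. x \<in> X \<Longrightarrow> (\<Sum>\<kappa>\<in>UNIV. a \<kappa> * z x \<kappa>) = 0"
    and nz: "\<exists>\<kappa>. s \<kappa> = R \<and> a \<kappa> \<noteq> 0"
  shows "R * real (card X) \<le> real (CARD('k) + 2) * 4 ^ CARD('k) * (\<Prod>\<kappa>\<in>UNIV. s \<kappa>)"
proof -
  define I where "I = {\<kappa>. s \<kappa> = R}"
  have "I \<noteq> {}" using nz by (auto simp: I_def)
  then have "Max ((\<lambda>\<kappa>. \<bar>a \<kappa>\<bar>) ` I) \<in> (\<lambda>\<kappa>. \<bar>a \<kappa>\<bar>) ` I" by (intro Max_in) auto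
  then obtain \<iota> where \<iota>: "\<iota> \<in> I" and "Max ((\<lambda>\<kappa>. \<bar>a \<kappa>\<bar>) ` I) = \<bar>a \<iota>\<bar>" by auto
  then have max: "\<bar>a \<kappa>\<bar> \<le> \<bar>a \<iota>\<bar>" if "\<kappa> \<in> I" for \<kappa>
    using Max_ge[of "(\<lambda>\<kappa>. \<bar>a \<kappa>\<bar>) ` I" "\<bar>a \<kappa>\<bar>"] that by simp
  have a\<iota>: "0 < \<bar>a \<iota>\<bar>" using nz max by (fastforce simp: I_def)
  have sR: "s \<iota> = R" using \<iota> by (simp add: I_def)
  define K where "K = int (CARD('k) + 2)"
  \<comment> \<open>Since \<bar>z\<bar> \<le> s, the floor of z lies between -s - 1 and s, and s
    \<ge> 1 turns the count 2s + 2 into 4s. In the direction \<iota> only the K residues are left,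
    which saves the factor s \<iota> = R.\<close>
  define A where "A \<kappa> = (if \<kappa> = \<iota> then {0..<K} else {k::int. - s \<kappa> - 1 \<le> k \<and> k \<le> s \<kappa>})" for \<kappa>
  define g where "g x \<kappa> = (if \<kappa> = \<iota> then \<lfloor>z x \<kappa>\<rfloor> mod K else \<lfloor>z x \<kappa>\<rfloor>)" for x \<kappa>
  have Apos: "finite (A \<kappa>)" "real (card (A \<kappa>)) \<le> (if \<kappa> = \<iota> then real_of_int K else 4 * s \<kappa>)" for \<kappa>
  proof -
    let ?I = "{k::int. - s \<kappa> - 1 \<le> k \<and> k \<le> s \<kappa>}" and ?J = "{- \<lfloor>s \<kappa>\<rfloor> - 1..\<lfloor>s \<kappa>\<rfloor>}"
    have sub: "?I \<subseteq> ?J" by (auto; linarith)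
    then have "card ?I \<le> card ?J" by (intro card_mono) auto
    moreover have "real (card ?J) \<le> 4 * s \<kappa>" using s1[of \<kappa>] by simp linarith
    ultimately have "real (card ?I) \<le> 4 * s \<kappa>" by linarith
    moreover have "finite ?I" using sub by (rule finite_subset) simp
    ultimately show "finite (A \<kappa>)" "real (card (A \<kappa>)) \<le> (if \<kappa> = \<iota> then real_of_int K else 4 * s \<kappa>)"
      by (auto simp: A_def K_def)
  qed
  have "inj_on g X"
  proof (rule inj_onI)
    fix x y assume x: "x \<in> X" and y: "y \<in> X" and eq: "g x = g y"
    have fl: "\<lfloor>z x \<kappa>\<rfloor> = \<lfloor>z y \<kappa>\<rfloor>" if "\<kappa> \<noteq> \<iota>" for \<kappa>
      using fun_cong[OF eq, of \<kappa>] that by (simp add: g_def)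
    have each: "\<bar>a \<kappa> * (z x \<kappa> - z y \<kappa>)\<bar> \<le> \<bar>a \<iota>\<bar>" if "\<kappa> \<noteq> \<iota>" for \<kappa>
    proof (cases "\<kappa> \<in> I")
      case True
      have "\<bar>z x \<kappa> - z y \<kappa>\<bar> \<le> 1" using fl[OF that] by linarith
      then have "\<bar>a \<kappa>\<bar> * \<bar>z x \<kappa> - z y \<kappa>\<bar> \<le> \<bar>a \<iota>\<bar> * 1" using max[OF True] by (intro mult_mono) auto
      then show ?thesis by (simp add: abs_mult)
    next
      case False
      \<comment> \<open>Off \<open>I\<close> the entries are integers, so equal floors mean equal
        entries and the term vanishes however large its coefficient. This is why \<bar>a
        \<iota>\<bar> only has to be maximal over \<open>I\<close>.\<close>
      then have "z x \<kappa> \<in> \<int>" "z y \<kappa> \<in> \<int>" using int[OF x] int[OF y] by (auto simp: I_def)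
      then have "z x \<kappa> = z y \<kappa>" using fl[OF that] by (metis floor_of_int Ints_cases)
      then show ?thesis by simp
    qed
    have "0 = (\<Sum>\<kappa>\<in>UNIV. a \<kappa> * (z x \<kappa> - z y \<kappa>))"
      using hyp[OF x] hyp[OF y] by (simp add: right_diff_distrib sum_subtractf)
    also have "\<dots> = a \<iota> * (z x \<iota> - z y \<iota>) + (\<Sum>\<kappa>\<in>UNIV-{\<iota>}. a \<kappa> * (z x \<kappa> - z y \<kappa>))"
      by (rule sum.remove) auto
    finally have "\<bar>a \<iota> * (z x \<iota> - z y \<iota>)\<bar> = \<bar>\<Sum>\<kappa>\<in>UNIV-{\<iota>}. a \<kappa> * (z x \<kappa> - z y \<kappa>)\<bar>" by linarith
    also have "\<dots> \<le> (\<Sum>\<kappa>\<in>UNIV-{\<iota>}. \<bar>a \<kappa> * (z x \<kappa> - z y \<kappa>)\<bar>)" by (rule sum_abs)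
    also have "\<dots> \<le> (\<Sum>\<kappa>\<in>UNIV-{\<iota>}. \<bar>a \<iota>\<bar>)" using each by (intro sum_mono) auto
    also have "\<dots> \<le> real CARD('k) * \<bar>a \<iota>\<bar>" by (auto intro!: mult_right_mono simp: card_Diff_singleton)
    finally have "\<bar>a \<iota>\<bar> * \<bar>z x \<iota> - z y \<iota>\<bar> \<le> \<bar>a \<iota>\<bar> * real CARD('k)" by (simp add: abs_mult mult.commute)
    then have "\<bar>z x \<iota> - z y \<iota>\<bar> \<le> real CARD('k)" using a\<iota> by simp
    then have "\<bar>\<lfloor>z x \<iota>\<rfloor> - \<lfloor>z y \<iota>\<rfloor>\<bar> < K" unfolding K_def by linarith
    moreover have "\<lfloor>z x \<iota>\<rfloor> mod K = \<lfloor>z y \<iota>\<rfloor> mod K" using fun_cong[OF eq, of \<iota>] by (simp add: g_def)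
    then have "K dvd \<lfloor>z x \<iota>\<rfloor> - \<lfloor>z y \<iota>\<rfloor>" by (simp add: mod_eq_dvd_iff)
    ultimately have "\<lfloor>z x \<iota>\<rfloor> = \<lfloor>z y \<iota>\<rfloor>" using dvd_imp_le_int[of "\<lfloor>z x \<iota>\<rfloor> - \<lfloor>z y \<iota>\<rfloor>" K]
      by (auto simp: K_def)
    with fl have "(\<lambda>\<kappa>. \<lfloor>z x \<kappa>\<rfloor>) = (\<lambda>\<kappa>. \<lfloor>z y \<kappa>\<rfloor>)" by metis
    then show "x = y" using inj x y by (simp add: inj_on_def)
  qed
  moreover have "g ` X \<subseteq> PiE UNIV A"
  proof -
    have "g x \<kappa> \<in> A \<kappa>" if "x \<in> X" for x \<kappa>
    proof (cases "\<kappa> = \<iota>")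
      case False
      have "- s \<kappa> - 1 \<le> real_of_int \<lfloor>z x \<kappa>\<rfloor>" "real_of_int \<lfloor>z x \<kappa>\<rfloor> \<le> s \<kappa>"
        using z_le[OF that, of \<kappa>] by linarith+
      then show ?thesis using False by (simp add: g_def A_def)
    qed (simp add: g_def A_def K_def)
    then show ?thesis by auto
  qed
  moreover have "finite (PiE UNIV A)" using Apos(1) by (intro finite_PiE) auto
  ultimately have "card X \<le> card (PiE UNIV A)" by (rule card_inj_on_le)
  then have "real (card X) \<le> (\<Prod>\<kappa>\<in>UNIV. real (card (A \<kappa>)))" by (simp only: card_PiE finite of_nat_le_iff flip: of_nat_prod)
  also have "\<dots> \<le> (\<Prod>\<kappa>\<in>UNIV. if \<kappa> = \<iota> then real_of_int K else 4 * s \<kappa>)"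
    using Apos(2) by (intro prod_mono) auto
  also have "\<dots> = real_of_int K * (\<Prod>\<kappa>\<in>UNIV-{\<iota>}. 4 * s \<kappa>)"
    by (subst prod.remove[of _ \<iota>]) auto
  finally have "R * real (card X) \<le> R * (real_of_int K * (\<Prod>\<kappa>\<in>UNIV-{\<iota>}. 4 * s \<kappa>))"
    using s1[of \<iota>] sR by (intro mult_left_mono) auto
  also have "\<dots> = real_of_int K * 4 ^ (CARD('k) - 1) * (s \<iota> * (\<Prod>\<kappa>\<in>UNIV-{\<iota>}. s \<kappa>))"
    using sR by (simp add: prod.distrib card_Diff_singleton)
  also have "s \<iota> * (\<Prod>\<kappa>\<in>UNIV-{\<iota>}. s \<kappa>) = (\<Prod>\<kappa>\<in>UNIV. s \<kappa>)"
    by (rule prod.remove[symmetric]) auto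
  also have "real_of_int K * 4 ^ (CARD('k) - 1) * (\<Prod>\<kappa>\<in>UNIV. s \<kappa>)
      \<le> real_of_int K * 4 ^ CARD('k) * (\<Prod>\<kappa>\<in>UNIV. s \<kappa>)"
    using s1 by (intro mult_right_mono mult_left_mono power_increasing prod_nonneg)
      (auto simp: K_def intro: order_trans[OF zero_le_one])
  finally show ?thesis by (simp add: K_def)
qed

section \<open>The spanning case\<close>

lemma dist_nearest_int_le: "dist_nearest_int x \<le> \<bar>x - of_int m\<bar>"
  unfolding dist_nearest_int_def by (rule round_diff_minimal)

lemma dist_nearest_int_nonneg: "0 \<le> dist_nearest_int x"
  by (simp add: dist_nearest_int_def)

lemma dist_nearest_int_le_half: "dist_nearest_int x \<le> 1 / 2"
  using of_int_round_abs_le[of x] by (simp add: dist_nearest_int_def abs_minus_commute)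

lemma dist_nearest_int_add: "dist_nearest_int (x + y) \<le> dist_nearest_int x + dist_nearest_int y"
  using dist_nearest_int_le[of "x + y" "round x + round y"]
  unfolding dist_nearest_int_def[of x] dist_nearest_int_def[of y] by simp

lemma dist_nearest_int_diff: "dist_nearest_int (x - y) \<le> dist_nearest_int x + dist_nearest_int y"
  using dist_nearest_int_le[of "x - y" "round x - round y"]
  unfolding dist_nearest_int_def[of x] dist_nearest_int_def[of y] by simp

text \<open>Modulo 1 the difference is n / K with n \<equiv> a - b mod K, and n is nonzero because 0
  < \<bar>a - b\<bar> < K. It separates the points of the torus grid in the volume bound.\<close>

lemma dist_nearest_int_fraction_ge:
  fixes a b K :: nat
  assumes "a < K" "b < K" "a \<noteq> b"
  shows "1 / real K \<le> dist_nearest_int (real a / real K - real b / real K)"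
proof -
  define m where "m = round (real a / real K - real b / real K)"
  define n where "n = int a - int b - m * int K"
  have "n \<noteq> 0"
  proof
    assume "n = 0"
    then have "int K dvd int a - int b" by (simp add: n_def)
    with assms dvd_imp_le_int[of "int a - int b" "int K"] show False by auto
  qed
  then have "1 \<le> \<bar>real_of_int n\<bar>" by linarith
  moreover have "real a / real K - real b / real K - of_int m = of_int n / real K"
    using assms by (simp add: n_def field_simps)
  ultimately show ?thesis
    using assms by (simp add: dist_nearest_int_def m_def[symmetric] divide_right_mono)
qed

text \<open>Only the class of \<open>t\<close> modulo 1 matters, so \<open>t\<close> is a point of
  the torus. Nonzero targets serve to place translates; the counts for the theorem have target 0,
  and there the zero vector is included.\<close>

definition near :: "real^'n^'m \<Rightarrow> real^'n \<Rightarrow> ('m \<Rightarrow> real) \<Rightarrow> ('m \<Rightarrow> real) \<Rightarrow> (int^'n) set" where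
  "near L Q t h = {q. (\<forall>j. \<bar>real_of_int (q $ j)\<bar> \<le> Q $ j) \<and>
     (\<forall>i. dist_nearest_int (lin_form L i q - t i) \<le> h i)}"

lemma lin_form_add: "lin_form L i (p + q) = lin_form L i p + lin_form L i q"
  by (simp add: lin_form_def algebra_simps sum.distrib)

lemma lin_form_diff: "lin_form L i (p - q) = lin_form L i p - lin_form L i q"
  by (simp add: lin_form_def algebra_simps sum_subtractf)

lemma finite_near: "(\<And>j. 0 \<le> Q $ j) \<Longrightarrow> finite (near L Q t h)"
  by (rule finite_subset[OF _ card_int_box_le(1)[of "\<lambda>j. Q $ j"]]) (auto simp: near_def)

text \<open>If every target can be approximated, then the neighbourhood of every point of a grid in the
  torus receives a translated copy of \<open>near L Q (\<lambda>_. 0) h\<close>, and these copies are disjoint.\<close>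

lemma card_near_le_volume:
  fixes L :: "real^'n::finite^'m::finite"
  assumes Q: "\<And>j. 1 \<le> Q $ j" and h: "\<And>i. 0 < h i" and c: "0 \<le> c"
    and approx: "\<And>t. near L (c *\<^sub>R Q) t (\<lambda>i. c * h i) \<noteq> {}"
  shows "real (card (near L Q (\<lambda>_. 0) h))
    \<le> (2 * c + 3) ^ CARD('n) * (8 * (c + 1)) ^ CARD('m) * ((\<Prod>j\<in>UNIV. Q $ j) * (\<Prod>i\<in>UNIV. h i))"
proof -
  have Q0: "0 \<le> Q $ j" for j using Q[of j] by linarith
  define N where "N = card (near L Q (\<lambda>_. 0) h)"
  \<comment> \<open>The grid spacing 1 / \<open>K i\<close> is to be at least 4(c +
    1)\<open>h i\<close>, twice the largest distance 2(c + 1)\<open>h i\<close> at which two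
    neighbourhoods can still meet. The \<open>max 1\<close> keeps one grid point when
    \<open>h i\<close> is large; rounding down costs at most a factor 2, hence the constant 8
    later.\<close>
  define K where "K i = max 1 (nat \<lfloor>1 / (4 * (c + 1) * h i)\<rfloor>)" for i
  define G where "G = PiE UNIV (\<lambda>i. {..<K i})"
  define t where "t g i = real (g i) / real (K i)" for g i
  define Y where "Y g = near L ((c + 1) *\<^sub>R Q) (t g) (\<lambda>i. (c + 1) * h i)" for g
  define Box where "Box = {q::int^'n. \<forall>j. \<bar>real_of_int (q $ j)\<bar> \<le> (c + 1) * Q $ j}"
  have ch: "0 < 4 * (c + 1) * h i" for i using c h[of i] by simp
  have K_ge: "1 / (8 * (c + 1) * h i) \<le> real (K i)" for i
  proof -
    have "x / 2 \<le> real (max 1 (nat \<lfloor>x\<rfloor>))" for x :: real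
    proof (cases "x < 1")
      case False
      then have "1 \<le> \<lfloor>x\<rfloor>" by simp
      then have "x / 2 \<le> real_of_int \<lfloor>x\<rfloor>" by linarith
      moreover have "max 1 (nat \<lfloor>x\<rfloor>) = nat \<lfloor>x\<rfloor>" using \<open>1 \<le> \<lfloor>x\<rfloor>\<close> by (simp add: max_absorb2 le_nat_iff)
      ultimately show ?thesis using \<open>1 \<le> \<lfloor>x\<rfloor>\<close> by simp
    qed simp
    moreover have "1 / (8 * (c + 1) * h i) = 1 / (4 * (c + 1) * h i) / 2" by simp
    ultimately show ?thesis unfolding K_def using ch[of i] by metis
  qed
  have Y_fin: "finite (Y g)" for g
    unfolding Y_def using c Q0 by (intro finite_near) simp
  have Y_card: "N \<le> card (Y g)" for g
  proof -
    obtain p where p: "p \<in> near L (c *\<^sub>R Q) (t g) (\<lambda>i. c * h i)" using approx by blast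
    have "q + p \<in> Y g" if q: "q \<in> near L Q (\<lambda>_. 0) h" for q
    proof -
      have "\<bar>real_of_int ((q + p) $ j)\<bar> \<le> (c + 1) * Q $ j" for j
      proof -
        have "\<bar>real_of_int (q $ j)\<bar> \<le> Q $ j" "\<bar>real_of_int (p $ j)\<bar> \<le> c * Q $ j"
          using p q by (auto simp: near_def)
        then show ?thesis by (simp add: algebra_simps)
      qed
      moreover have "dist_nearest_int (lin_form L i (q + p) - t g i) \<le> (c + 1) * h i" for i
      proof -
        have "dist_nearest_int (lin_form L i q) \<le> h i"
          "dist_nearest_int (lin_form L i p - t g i) \<le> c * h i" using p q by (auto simp: near_def)
        then show ?thesis using dist_nearest_int_add[of "lin_form L i q" "lin_form L i p - t g i"]
          by (simp add: lin_form_add algebra_simps)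
      qed
      ultimately show ?thesis by (simp add: Y_def near_def)
    qed
    then have "(\<lambda>q. q + p) ` near L Q (\<lambda>_. 0) h \<subseteq> Y g" by blast
    then show ?thesis unfolding N_def using Y_fin by (intro card_inj_on_le) auto
  qed
  have disj: "Y g \<inter> Y g' = {}" if g: "g \<in> G" "g' \<in> G" "g \<noteq> g'" for g g'
  proof (rule ccontr)
    assume "Y g \<inter> Y g' \<noteq> {}"
    then obtain q where q: "q \<in> Y g" "q \<in> Y g'" by blast
    obtain i where i: "g i \<noteq> g' i" using g(3) by blast
    have lt: "g i < K i" "g' i < K i" using g by (auto simp: G_def)
    with i have "2 \<le> K i" by linarith
    then have "K i = nat \<lfloor>1 / (4 * (c + 1) * h i)\<rfloor>" by (simp add: K_def)
    then have "real (K i) \<le> 1 / (4 * (c + 1) * h i)"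
      using ch[of i] of_nat_floor[of "1 / (4 * (c + 1) * h i)"] by simp
    then have "4 * (c + 1) * h i \<le> 1 / real (K i)"
      using ch[of i] \<open>2 \<le> K i\<close> by (simp add: field_simps)
    moreover have "1 / real (K i) \<le> dist_nearest_int (t g i - t g' i)"
      unfolding t_def using dist_nearest_int_fraction_ge[OF lt i] .
    moreover have "dist_nearest_int (t g i - t g' i) \<le> (c + 1) * h i + (c + 1) * h i"
    proof -
      have "dist_nearest_int (lin_form L i q - t g i) \<le> (c + 1) * h i"
        "dist_nearest_int (lin_form L i q - t g' i) \<le> (c + 1) * h i"
        using q by (auto simp: Y_def near_def)
      moreover have "t g i - t g' i = (lin_form L i q - t g' i) - (lin_form L i q - t g i)" by simp
      ultimately show ?thesis by (metis add_mono dist_nearest_int_diff order_trans)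
    qed
    moreover have "4 * (c + 1) * h i = 2 * ((c + 1) * h i + (c + 1) * h i)" by (simp add: algebra_simps)
    ultimately show False using ch[of i] by linarith
  qed
  have G_fin: "finite G" unfolding G_def by (intro finite_PiE) auto
  have Box: "finite Box" "real (card Box) \<le> (\<Prod>j\<in>UNIV. 2 * ((c + 1) * Q $ j) + 1)"
    unfolding Box_def using card_int_box_le[of "\<lambda>j. (c + 1) * Q $ j"] c Q0 by auto
  have "N * card G = (\<Sum>g\<in>G. N)" by simp
  also have "\<dots> \<le> (\<Sum>g\<in>G. card (Y g))" using Y_card by (intro sum_mono)
  also have "\<dots> = card (\<Union>g\<in>G. Y g)"
    using G_fin Y_fin disj by (intro card_UN_disjoint[symmetric]) auto
  also have "\<dots> \<le> card Box"
    using Box(1) by (intro card_mono) (auto simp: Y_def near_def Box_def)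
  finally have "real (N * card G) \<le> real (card Box)" by (simp only: of_nat_le_iff)
  then have "real N * (\<Prod>i\<in>UNIV. real (K i)) \<le> (\<Prod>j\<in>UNIV. 2 * ((c + 1) * Q $ j) + 1)"
    using Box(2) by (simp add: G_def card_PiE)
  also have "\<dots> \<le> (\<Prod>j\<in>UNIV. (2 * c + 3) * Q $ j)"
  proof (rule prod_mono)
    fix j
    show "0 \<le> 2 * ((c + 1) * Q $ j) + 1 \<and> 2 * ((c + 1) * Q $ j) + 1 \<le> (2 * c + 3) * Q $ j"
      using Q[of j] Q0[of j] c by (simp add: algebra_simps)
  qed
  also have "\<dots> = (2 * c + 3) ^ CARD('n) * (\<Prod>j\<in>UNIV. Q $ j)" by (simp add: prod.distrib)
  finally have *: "real N * (\<Prod>i\<in>UNIV. real (K i)) \<le> (2 * c + 3) ^ CARD('n) * (\<Prod>j\<in>UNIV. Q $ j)" .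
  \<comment> \<open>The lower bound on the number of grid points is used here to trade the product
    of the \<open>K i\<close> for the volume of the target box.\<close>
  have "1 = (\<Prod>i\<in>UNIV. (1 / (8 * (c + 1) * h i)) * (8 * (c + 1) * h i))"
  proof -
    have "8 * (c + 1) * h i \<noteq> 0" for i using c h[of i] by simp
    then show ?thesis by simp
  qed
  also have "\<dots> \<le> (\<Prod>i\<in>UNIV. real (K i) * (8 * (c + 1) * h i))"
    using K_ge c h by (intro prod_mono conjI mult_right_mono) (auto simp: less_imp_le)
  also have "\<dots> = (\<Prod>i\<in>UNIV. real (K i)) * ((8 * (c + 1)) ^ CARD('m) * (\<Prod>i\<in>UNIV. h i))"
    by (simp add: prod.distrib)
  finally have "real N * 1 \<le> real N * ((\<Prod>i\<in>UNIV. real (K i)) * ((8 * (c + 1)) ^ CARD('m) * (\<Prod>i\<in>UNIV. h i)))"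
    by (intro mult_left_mono) auto
  also have "\<dots> = (real N * (\<Prod>i\<in>UNIV. real (K i))) * ((8 * (c + 1)) ^ CARD('m) * (\<Prod>i\<in>UNIV. h i))"
    by (simp only: mult.assoc)
  also have "\<dots> \<le> ((2 * c + 3) ^ CARD('n) * (\<Prod>j\<in>UNIV. Q $ j)) * ((8 * (c + 1)) ^ CARD('m) * (\<Prod>i\<in>UNIV. h i))"
    using c h by (intro mult_right_mono[OF *] mult_nonneg_nonneg prod_nonneg zero_le_power) (auto simp: less_imp_le)
  finally show ?thesis by (simp add: N_def mult_ac)
qed

text \<open>Among the lattice points (q, Lq + p) over a given q, the one closest to 0 in the last
  coordinates is chosen, so their absolute values are exactly the distances to the nearest
  integers.\<close>

definition lattice_vec :: "real^'n^'m \<Rightarrow> int^'n \<Rightarrow> (real^'n) \<times> (real^'m)" where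
  "lattice_vec L q = ((\<chi> j. real_of_int (q $ j)), (\<chi> i. lin_form L i q - of_int (round (lin_form L i q))))"

text \<open>Rounding the coefficients of \<open>(0, t)\<close> with respect to a basis consisting of lattice vectors
  produces the approximation.\<close>

lemma near_nonempty_of_span:
  fixes L :: "real^'n::finite^'m::finite" and t :: "'m \<Rightarrow> real"
  assumes Q: "\<And>j. 0 \<le> Q $ j" and h: "\<And>i. 0 \<le> h i"
    and span: "(0, \<chi> i. t i) \<in> span (lattice_vec L ` near L Q (\<lambda>_. 0) h)"
  defines "c \<equiv> real (CARD('n) + CARD('m))"
  shows "near L (c *\<^sub>R Q) t (\<lambda>i. c * h i) \<noteq> {}"
proof -
  let ?X = "near L Q (\<lambda>_. 0) h"
  obtain B where B: "B \<subseteq> lattice_vec L ` ?X" "independent B" "lattice_vec L ` ?X \<subseteq> span B"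
    using maximal_independent_subset by blast
  have finB: "finite B" and "card B \<le> DIM((real^'n) \<times> (real^'m))"
    using independent_bound[OF B(2)] by auto
  then have cardB: "real (card B) \<le> c" by (simp add: c_def)
  have "(0, \<chi> i. t i) \<in> span B" using span B(3) span_mono span_span by blast
  then obtain u where u: "(0, \<chi> i. t i) = (\<Sum>b\<in>B. u b *\<^sub>R b)"
    unfolding span_finite[OF finB] by blast
  define r where "r = inv_into ?X (lattice_vec L)"
  have r: "r b \<in> ?X" "lattice_vec L (r b) = b" if "b \<in> B" for b
    using that B(1) by (auto simp: r_def intro!: inv_into_into f_inv_into_f)
  define p where "p = (\<Sum>b\<in>B. (\<chi> j. \<lfloor>u b\<rfloor> * r b $ j))"
  have fr: "\<bar>u b - of_int \<lfloor>u b\<rfloor>\<bar> \<le> 1" for b by linarith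
  have bound: "\<bar>\<Sum>b\<in>B. (of_int \<lfloor>u b\<rfloor> - u b) * w b\<bar> \<le> c * s" if "\<And>b. b \<in> B \<Longrightarrow> \<bar>w b\<bar> \<le> s" "0 \<le> s" for w s
  proof -
    have "\<bar>\<Sum>b\<in>B. (of_int \<lfloor>u b\<rfloor> - u b) * w b\<bar> \<le> (\<Sum>b\<in>B. \<bar>(of_int \<lfloor>u b\<rfloor> - u b) * w b\<bar>)" by (rule sum_abs)
    also have "\<dots> \<le> (\<Sum>b\<in>B. 1 * s)" unfolding abs_mult
      using that fr by (intro sum_mono mult_mono) (auto simp: abs_minus_commute)
    also have "\<dots> \<le> c * s" using cardB that(2) by (simp add: mult_right_mono)
    finally show ?thesis .
  qed
  have "\<bar>real_of_int (p $ j)\<bar> \<le> c * Q $ j" for j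
  proof -
    \<comment> \<open>The first component of (0, t) is 0, so the unrounded combination has no box
      part and \<open>p\<close> consists of rounding errors alone.\<close>
    have "0 = (\<Sum>b\<in>B. u b * real_of_int (r b $ j))"
    proof -
      have "0 = fst (\<Sum>b\<in>B. u b *\<^sub>R b) $ j" by (simp flip: u)
      also have "\<dots> = (\<Sum>b\<in>B. u b * fst (lattice_vec L (r b)) $ j)"
        using r by (simp add: fst_sum)
      finally show ?thesis by (simp add: lattice_vec_def)
    qed
    then have "real_of_int (p $ j) = (\<Sum>b\<in>B. (of_int \<lfloor>u b\<rfloor> - u b) * real_of_int (r b $ j))"
      by (simp add: p_def left_diff_distrib sum_subtractf)
    also have "\<bar>\<dots>\<bar> \<le> c * Q $ j"
      using r(1) Q by (intro bound) (auto simp: near_def)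
    finally show ?thesis .
  qed
  moreover have "dist_nearest_int (lin_form L i p - t i) \<le> c * h i" for i
  proof -
    define y where "y b = lin_form L i (r b) - of_int (round (lin_form L i (r b)))" for b
    have t: "t i = (\<Sum>b\<in>B. u b * y b)"
    proof -
      have "t i = snd (\<Sum>b\<in>B. u b *\<^sub>R b) $ i" by (simp flip: u)
      also have "\<dots> = (\<Sum>b\<in>B. u b * snd (lattice_vec L (r b)) $ i)"
        using r by (simp add: snd_sum)
      finally show ?thesis by (simp add: lattice_vec_def y_def)
    qed
    have "lin_form L i p = (\<Sum>b\<in>B. of_int \<lfloor>u b\<rfloor> * lin_form L i (r b))"
      unfolding lin_form_def p_def sum_distrib_left sum_component of_int_sum
      by (subst sum.swap) (simp add: mult_ac)
    \<comment> \<open>With integer coefficients the roundings of the forms add up to an integer,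
      which is invisible to the distance to the nearest integer.\<close>
    also have "\<dots> = (\<Sum>b\<in>B. of_int \<lfloor>u b\<rfloor> * y b) + of_int (\<Sum>b\<in>B. \<lfloor>u b\<rfloor> * round (lin_form L i (r b)))"
      by (simp add: y_def algebra_simps sum_subtractf)
    finally have "lin_form L i p - t i - of_int (\<Sum>b\<in>B. \<lfloor>u b\<rfloor> * round (lin_form L i (r b)))
        = (\<Sum>b\<in>B. (of_int \<lfloor>u b\<rfloor> - u b) * y b)"
      by (simp add: t left_diff_distrib sum_subtractf)
    also have "\<bar>\<dots>\<bar> \<le> c * h i"
      using r(1) h by (intro bound) (auto simp: near_def y_def dist_nearest_int_def)
    finally show ?thesis using dist_nearest_int_le order_trans by blast
  qed
  ultimately have "p \<in> near L (c *\<^sub>R Q) t (\<lambda>i. c * h i)" by (simp add: near_def)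
  then show ?thesis by blast
qed

section \<open>The counting estimate\<close>

lemma prod_UNIV_sum:
  fixes f :: "'a::finite + 'b::finite \<Rightarrow> 'c::comm_monoid_mult"
  shows "prod f UNIV = (\<Prod>x\<in>UNIV. f (Inl x)) * (\<Prod>y\<in>UNIV. f (Inr y))"
  using prod.Plus[of "UNIV :: 'a set" "UNIV :: 'b set" f] by simp

lemma sum_UNIV_sum:
  fixes f :: "'a::finite + 'b::finite \<Rightarrow> 'c::comm_monoid_add"
  shows "sum f UNIV = (\<Sum>x\<in>UNIV. f (Inl x)) + (\<Sum>y\<in>UNIV. f (Inr y))"
  using sum.Plus[of "UNIV :: 'a set" "UNIV :: 'b set" f] by simp

text \<open>R is the number of pieces, up to a constant, into which each side is cut; a side with
  \<open>Q $ j\<close> < R is cut only down to unit length, where integers are already separated. T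
  is the resulting number of cells. The intermediate value theorem applies, as the product is at
  most 1 at R = 1 and at least T at R = T.\<close>

lemma ex_cell_scale:
  fixes Q :: "real^'n::finite"
  assumes Q: "\<And>j. 1 \<le> Q $ j" and T: "1 \<le> T" and M: "0 < M"
  obtains R where "1 \<le> R" "(\<Prod>j\<in>UNIV. min (Q $ j) R) * R ^ M = T"
proof -
  have "\<exists>R. 1 \<le> R \<and> R \<le> T \<and> (\<Prod>j\<in>UNIV. min (Q $ j) R) * R ^ M = T"
  proof (rule IVT')
    have "(\<Prod>j\<in>UNIV. min (Q $ j) 1) \<le> 1" using Q by (intro prod_le_1) (auto simp: min_def intro: order_trans[OF zero_le_one])
    then show "(\<Prod>j\<in>UNIV. min (Q $ j) 1) * 1 ^ M \<le> T" using T by simp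
    have "1 \<le> (\<Prod>j\<in>UNIV. min (Q $ j) T)" using Q T by (intro prod_ge_1) auto
    moreover have "T \<le> T ^ M" using T M by (intro self_le_power) auto
    ultimately show "T \<le> (\<Prod>j\<in>UNIV. min (Q $ j) T) * T ^ M"
      using T mult_mono[of 1 "\<Prod>j\<in>UNIV. min (Q $ j) T" T "T ^ M"] by simp
    show "continuous_on {1..T} (\<lambda>R. (\<Prod>j\<in>UNIV. min (Q $ j) R) * R ^ M)"
      by (intro continuous_intros)
  qed (rule T)
  then show ?thesis using that by blast
qed

text \<open>The scale R makes the volume of a cell, with sides \<open>Q $ j\<close> / s and
  \<open>h i\<close> / R, exactly \<delta>. Two points in one cell would differ by a vector
  violating \<open>bad\<close>, so cells separate points and the hyperplane count applies.\<close>

lemma card_near_le_of_hyperplane: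
  fixes L :: "real^'n::finite^'m::finite" and a :: "(real^'n) \<times> (real^'m)"
  assumes Q: "\<And>j. 1 \<le> Q $ j" and h: "\<And>i. 0 < h i" and \<delta>: "0 < \<delta>"
    and bad: "\<And>q. q \<noteq> 0 \<Longrightarrow> (\<And>j. \<bar>real_of_int (q $ j)\<bar> \<le> Q $ j) \<Longrightarrow>
      \<delta> \<le> height_prod q * (\<Prod>i\<in>UNIV. dist_nearest_int (lin_form L i q))"
    and T: "T = (\<Prod>j\<in>UNIV. Q $ j) * (\<Prod>i\<in>UNIV. h i) / \<delta>" "1 \<le> T"
    and hyp: "\<And>q. q \<in> near L Q (\<lambda>_. 0) h \<Longrightarrow> a \<bullet> lattice_vec L q = 0"
    and nz: "snd a \<noteq> 0"
  defines "d \<equiv> CARD('n) + CARD('m)"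
  shows "real (card (near L Q (\<lambda>_. 0) h)) \<le> real (d + 2) * 4 ^ d * T powr (1 - 1 / real d)"
proof -
  let ?X = "near L Q (\<lambda>_. 0) h"
  have Q0: "0 < Q $ j" for j using Q[of j] by linarith
  obtain R where R: "1 \<le> R" "(\<Prod>j\<in>UNIV. min (Q $ j) R) * R ^ CARD('m) = T"
    using ex_cell_scale[OF Q T(2), of "CARD('m)"] by auto
  \<comment> \<open>The sum type indexes the d coordinates of a lattice point. The map
    \<open>z\<close> rescales the box to \<bar>z \<kappa>\<bar> \<le> s \<kappa>, turning cells into
    unit cubes, and \<open>b\<close> is the normal \<open>a\<close> in the new coordinates.\<close>
  define s :: "'n + 'm \<Rightarrow> real" where "s = case_sum (\<lambda>j. min (Q $ j) R) (\<lambda>_. R)"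
  define y where "y q i = lin_form L i q - of_int (round (lin_form L i q))" for q i
  define z :: "int^'n \<Rightarrow> 'n + 'm \<Rightarrow> real" where
    "z q = case_sum (\<lambda>j. of_int (q $ j) * s (Inl j) / Q $ j) (\<lambda>i. y q i * R / h i)" for q
  define b :: "'n + 'm \<Rightarrow> real" where
    "b = case_sum (\<lambda>j. fst a $ j * Q $ j / s (Inl j)) (\<lambda>i. snd a $ i * h i / R)"
  have s_simps: "s (Inl j) = min (Q $ j) R" "s (Inr i) = R" for i j by (simp_all add: s_def)
  have s1: "1 \<le> s \<kappa>" for \<kappa> using Q R(1) by (cases \<kappa>) (auto simp: s_simps)
  have s0: "0 < s \<kappa>" for \<kappa> using s1[of \<kappa>] by linarith
  have prod_s: "prod s UNIV = T" using R(2) by (simp add: prod_UNIV_sum s_simps)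
  have "R * real (card ?X) \<le> real (CARD('n + 'm) + 2) * 4 ^ CARD('n + 'm) * prod s UNIV"
  proof (rule card_le_of_hyperplane[where z = z and a = b, OF s1])
    fix q \<kappa> assume q: "q \<in> ?X"
    show "\<bar>z q \<kappa>\<bar> \<le> s \<kappa>"
    proof (cases \<kappa>)
      case (Inl j)
      have "\<bar>real_of_int (q $ j)\<bar> \<le> Q $ j" using q by (simp add: near_def)
      then have "\<bar>real_of_int (q $ j)\<bar> * s \<kappa> \<le> Q $ j * s \<kappa>" using s0[of \<kappa>] by (intro mult_right_mono) auto
      then show ?thesis using Inl Q0[of j] s0[of \<kappa>] by (simp add: z_def abs_mult field_simps)
    next
      case (Inr i)
      have "\<bar>y q i\<bar> \<le> h i" using q by (simp add: near_def y_def dist_nearest_int_def)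
      then have "\<bar>y q i\<bar> * R \<le> h i * R" using R(1) by (intro mult_right_mono) auto
      then show ?thesis using Inr h[of i] R(1) by (simp add: z_def s_simps abs_mult field_simps)
    qed
    show "z q \<kappa> \<in> \<int>" if "s \<kappa> \<noteq> R"
      \<comment> \<open>If s \<noteq> R, then s is \<open>Q $ j\<close> itself and the rescaled
        coordinate is the integer \<open>q $ j\<close>.\<close>
      using that Q0 by (cases \<kappa>) (auto simp: s_simps z_def min_def less_imp_neq[symmetric] split: if_splits)
  next
    fix q assume q: "q \<in> ?X"
    have "(\<Sum>\<kappa>\<in>UNIV. b \<kappa> * z q \<kappa>) = (\<Sum>j\<in>UNIV. fst a $ j * of_int (q $ j)) + (\<Sum>i\<in>UNIV. snd a $ i * y q i)"
      using s0 Q0 h R(1) by (simp add: sum_UNIV_sum b_def z_def less_imp_neq[symmetric])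
    also have "\<dots> = a \<bullet> lattice_vec L q"
      by (cases a) (simp add: lattice_vec_def inner_prod_def inner_vec_def y_def)
    finally show "(\<Sum>\<kappa>\<in>UNIV. b \<kappa> * z q \<kappa>) = 0" using hyp[OF q] by simp
  next
    obtain i where "snd a $ i \<noteq> 0" using nz by (metis vec_eq_iff zero_index)
    then have "b (Inr i) \<noteq> 0" using h[of i] R(1) by (simp add: b_def)
    then show "\<exists>\<kappa>. s \<kappa> = R \<and> b \<kappa> \<noteq> 0" using s_simps(2) by blast
  next
    show "inj_on (\<lambda>q \<kappa>. \<lfloor>z q \<kappa>\<rfloor>) ?X"
    proof (rule inj_onI, rule ccontr)
      fix p q assume p: "p \<in> ?X" and q: "q \<in> ?X" and eq: "(\<lambda>\<kappa>. \<lfloor>z p \<kappa>\<rfloor>) = (\<lambda>\<kappa>. \<lfloor>z q \<kappa>\<rfloor>)"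
        and neq: "p \<noteq> q"
      have cell: "\<bar>z p \<kappa> - z q \<kappa>\<bar> < 1" for \<kappa> using fun_cong[OF eq, of \<kappa>] by linarith
      have diff: "\<bar>real_of_int ((p - q) $ j)\<bar> < Q $ j / s (Inl j)" for j
      proof -
        have "z p (Inl j) - z q (Inl j) = real_of_int ((p - q) $ j) * (s (Inl j) / Q $ j)"
          by (simp add: z_def diff_divide_distrib left_diff_distrib)
        then have "\<bar>real_of_int ((p - q) $ j)\<bar> * (s (Inl j) / Q $ j) < 1"
          using cell[of "Inl j"] s0[of "Inl j"] Q0[of j] by (simp add: abs_mult)
        then show ?thesis using s0[of "Inl j"] Q0[of j] by (simp add: field_simps)
      qed
      have "\<bar>real_of_int ((p - q) $ j)\<bar> \<le> Q $ j" for j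
      proof -
        have "Q $ j / s (Inl j) \<le> Q $ j" using s1[of "Inl j"] Q0[of j] by (simp add: field_simps)
        then show ?thesis using diff[of j] by linarith
      qed
      then have "\<delta> \<le> height_prod (p - q) * (\<Prod>i\<in>UNIV. dist_nearest_int (lin_form L i (p - q)))"
        using neq by (intro bad) auto
      \<comment> \<open>The maximum with 1 in \<open>height_prod\<close> is harmless because each
        \<open>Q $ j\<close> / s is at least 1. Strictness comes from the rows;
        \<open>undefined\<close> below is just some row index.\<close>
      also have "\<dots> < (\<Prod>j\<in>UNIV. Q $ j / s (Inl j)) * (\<Prod>i\<in>UNIV. h i / R)"
      proof (rule mult_le_less_imp_less)
        have "1 \<le> Q $ j / s (Inl j)" for j using s0[of "Inl j"] by (simp add: s_simps)
        then show "height_prod (p - q) \<le> (\<Prod>j\<in>UNIV. Q $ j / s (Inl j))"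
          unfolding height_prod_def using diff by (intro prod_mono) (auto intro: less_imp_le)
        show "0 < height_prod (p - q)" unfolding height_prod_def by (intro prod_pos) auto
        show "0 \<le> (\<Prod>i\<in>UNIV. dist_nearest_int (lin_form L i (p - q)))"
          by (intro prod_nonneg) (simp add: dist_nearest_int_nonneg)
        have *: "dist_nearest_int (lin_form L i (p - q)) < h i / R" for i
        proof -
          have "z p (Inr i) - z q (Inr i) = (y p i - y q i) * (R / h i)"
            by (simp add: z_def diff_divide_distrib left_diff_distrib)
          then have "\<bar>y p i - y q i\<bar> * (R / h i) < 1"
            using cell[of "Inr i"] R(1) h[of i] by (simp add: abs_mult)
          then have "\<bar>y p i - y q i\<bar> < h i / R" using R(1) h[of i] by (simp add: field_simps)
          then show ?thesis
            using dist_nearest_int_le[of "lin_form L i (p - q)" "round (lin_form L i p) - round (lin_form L i q)"]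
            by (simp add: y_def lin_form_diff algebra_simps)
        qed
        show "(\<Prod>i\<in>UNIV. dist_nearest_int (lin_form L i (p - q))) < (\<Prod>i\<in>UNIV. h i / R)"
          using * h R(1) by (intro prod_mono_strict[of undefined]) (auto simp: dist_nearest_int_nonneg less_imp_le)
      qed
      also have "\<dots> = (\<Prod>j\<in>UNIV. Q $ j) * (\<Prod>i\<in>UNIV. h i) / prod s UNIV"
        by (simp add: prod_UNIV_sum prod_dividef s_simps)
      also have "\<dots> = \<delta>" using T \<delta> unfolding prod_s by (auto simp: field_simps)
      finally show False by simp
    qed
  qed
  then have main: "R * real (card ?X) \<le> real (d + 2) * 4 ^ d * T" by (simp add: prod_s d_def)
  \<comment> \<open>Every side has at most R cells, so T \<le> R^d. This is the lower bound on R
    that becomes the saving T^(1/d).\<close>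
  have "T \<le> (\<Prod>\<kappa>\<in>(UNIV :: ('n + 'm) set). R)"
    unfolding prod_s[symmetric]
  proof (rule prod_mono)
    show "0 \<le> s \<kappa> \<and> s \<kappa> \<le> R" for \<kappa> using s0[of \<kappa>] by (cases \<kappa>) (auto simp: s_simps)
  qed
  then have "T \<le> R powr real d" using R(1) by (simp add: d_def powr_realpow powr_add power_add)
  moreover have "0 < d" by (simp add: d_def)
  ultimately have "T powr (1 / real d) \<le> (R powr real d) powr (1 / real d)"
    using T(2) by (intro powr_mono2) auto
  also have "\<dots> = R" using R(1) \<open>0 < d\<close> by (simp add: powr_powr)
  finally have "T powr (1 / real d) * real (card ?X) \<le> R * real (card ?X)" by (intro mult_right_mono) auto
  then have "T powr (1 / real d) * real (card ?X) \<le> real (d + 2) * 4 ^ d * T" using main by linarith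
  moreover have "T = T powr (1 - 1 / real d) * T powr (1 / real d)"
    using T(2) by (simp flip: powr_add)
  ultimately have "T powr (1 / real d) * real (card ?X)
      \<le> T powr (1 / real d) * (real (d + 2) * 4 ^ d * T powr (1 - 1 / real d))"
    by (simp add: mult_ac)
  moreover have "0 < T powr (1 / real d)" using T(2) by simp
  ultimately show ?thesis by (meson mult_le_cancel_left_pos)
qed

proposition card_near_le:
  fixes L :: "real^'n::finite^'m::finite"
  assumes Q: "\<And>j. 1 \<le> Q $ j" and h: "\<And>i. 0 < h i" and \<delta>: "0 < \<delta>"
    and bad: "\<And>q. q \<noteq> 0 \<Longrightarrow> (\<And>j. \<bar>real_of_int (q $ j)\<bar> \<le> Q $ j) \<Longrightarrow>
      \<delta> \<le> height_prod q * (\<Prod>i\<in>UNIV. dist_nearest_int (lin_form L i q))"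
    and W: "W = (\<Prod>j\<in>UNIV. Q $ j) * (\<Prod>i\<in>UNIV. h i)" "\<delta> \<le> W"
  defines "d \<equiv> CARD('n) + CARD('m)"
  shows "real (card (near L Q (\<lambda>_. 0) h))
    \<le> (2 * real d + 3) ^ CARD('n) * (8 * (real d + 1)) ^ CARD('m) * W
      + real (d + 2) * 4 ^ d * (W / \<delta>) powr (1 - 1 / real d)"
proof (cases "\<forall>t::real^'m. (0, t) \<in> span (lattice_vec L ` near L Q (\<lambda>_. 0) h)")
  case True
  \<comment> \<open>A basis has at most d elements, so rounding its coefficients loses a factor d;
    hence the value \<open>real d\<close> for c.\<close>
  then have "near L (real d *\<^sub>R Q) t (\<lambda>i. real d * h i) \<noteq> {}" for t
    using near_nonempty_of_span[of Q h t L] Q h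
    by (auto simp: d_def less_imp_le intro: order_trans[OF zero_le_one])
  then have "real (card (near L Q (\<lambda>_. 0) h))
    \<le> (2 * real d + 3) ^ CARD('n) * (8 * (real d + 1)) ^ CARD('m) * W"
    using card_near_le_volume[of Q h "real d" L] Q h W(1) by simp
  then show ?thesis by (simp add: add_increasing2)
next
  case False
  then obtain t :: "real^'m" where t: "(0, t) \<notin> span (lattice_vec L ` near L Q (\<lambda>_. 0) h)" by blast
  \<comment> \<open>The component \<open>a\<close> of (0, t) orthogonal to the span is the normal of
    the hyperplane. If \<open>snd a\<close> were 0, then \<open>a\<close> would be orthogonal to (0,
    t) and to x, hence to itself, and (0, t) = x would lie in the span.\<close>
  obtain x a where x: "x \<in> span (lattice_vec L ` near L Q (\<lambda>_. 0) h)"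
    and a: "\<And>w. w \<in> span (lattice_vec L ` near L Q (\<lambda>_. 0) h) \<Longrightarrow> orthogonal a w"
    and ta: "(0, t) = x + a"
    using orthogonal_subspace_decomp_exists by blast
  have "snd a \<noteq> 0"
  proof
    assume "snd a = 0"
    then have "a \<bullet> (0, t) = 0" by (simp add: inner_prod_def)
    moreover have "a \<bullet> x = 0" using a[OF x] by (simp add: orthogonal_def)
    ultimately have "a \<bullet> a = 0" by (simp add: ta inner_add_right)
    then show False using t ta x by simp
  qed
  moreover have "a \<bullet> lattice_vec L q = 0" if "q \<in> near L Q (\<lambda>_. 0) h" for q
    using a[of "lattice_vec L q"] that by (simp add: span_base orthogonal_def)
  moreover have "1 \<le> W / \<delta>" using W(2) \<delta> by simp
  ultimately have "real (card (near L Q (\<lambda>_. 0) h)) \<le> real (d + 2) * 4 ^ d * (W / \<delta>) powr (1 - 1 / real d)"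
    using card_near_le_of_hyperplane[where T = "W / \<delta>" and a = a, OF Q h \<delta> bad] W(1) by (simp add: d_def)
  moreover have "0 \<le> (2 * real d + 3) ^ CARD('n) * (8 * (real d + 1)) ^ CARD('m) * W"
    using W(2) \<delta> by simp
  ultimately show ?thesis by linarith
qed

section \<open>Dyadic summation\<close>

lemma ex_dyadic_scale:
  fixes x :: real
  assumes "0 < x" "x \<le> 1"
  shows "\<exists>k. (1 / 2) ^ Suc k < x \<and> x \<le> (1 / 2) ^ k"
proof -
  define n where "n = (LEAST n. (1 / 2) ^ n < x)"
  obtain m where "(1 / 2) ^ m < x" using real_arch_pow_inv[of x "1 / 2"] assms by auto
  then have n: "(1 / 2) ^ n < x" unfolding n_def by (rule LeastI)
  with assms obtain k where k: "n = Suc k" by (cases n) auto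
  then have "\<not> (1 / 2) ^ k < x" using not_less_Least[of k "\<lambda>n. (1 / 2) ^ n < x"] by (simp add: n_def)
  with n k show ?thesis by (intro exI[of _ k]) auto
qed

text \<open>Replacing one coordinate of \<open>k\<close> by the total turns the sum into a product of a geometric
  series and \<open>CARD('m) - 1\<close> trivial sums; this is where one logarithm is saved.\<close>

lemma sum_power_total_le:
  fixes r :: real and n :: nat
  defines "K \<equiv> {k :: 'm::finite \<Rightarrow> nat. sum k UNIV \<le> n}"
  assumes r: "1 < r"
  shows "finite K" and "real (card K) \<le> (real n + 1) ^ CARD('m)"
    and "(\<Sum>k\<in>K. r ^ sum k UNIV) \<le> r / (r - 1) * r ^ n * (real n + 1) ^ (CARD('m) - 1)"
proof -
  let ?P = "PiE (UNIV :: 'm set) (\<lambda>_. {..n})"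
  have P_fin: "finite ?P" by (intro finite_PiE) auto
  have le: "k i \<le> sum k UNIV" for k :: "'m \<Rightarrow> nat" and i by (intro member_le_sum) auto
  then have K_sub: "K \<subseteq> ?P" by (auto simp: K_def intro: order_trans)
  then show K_fin: "finite K" using P_fin by (rule finite_subset)
  have "card K \<le> card ?P" using P_fin K_sub by (rule card_mono)
  then have "card K \<le> (n + 1) ^ CARD('m)" by (simp add: card_PiE)
  then have "real (card K) \<le> real ((n + 1) ^ CARD('m))" by (simp only: of_nat_le_iff)
  then show "real (card K) \<le> (real n + 1) ^ CARD('m)" by (simp add: add.commute)
  define \<iota> :: 'm where "\<iota> = undefined"
  define G where "G k = k(\<iota> := sum k UNIV)" for k :: "'m \<Rightarrow> nat"
  have inj: "inj_on G K"
  proof (rule inj_onI)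
    fix k l assume eq: "G k = G l"
    have off: "k i = l i" if "i \<noteq> \<iota>" for i using fun_cong[OF eq, of i] that by (simp add: G_def)
    have "sum k UNIV = sum l UNIV" using fun_cong[OF eq, of \<iota>] by (simp add: G_def)
    moreover have "sum k (UNIV - {\<iota>}) = sum l (UNIV - {\<iota>})" using off by (intro sum.cong) auto
    ultimately have "k \<iota> = l \<iota>" by (simp add: sum.remove[of UNIV \<iota>])
    with off show "k = l" by (metis ext)
  qed
  have "(\<Sum>k\<in>K. r ^ sum k UNIV) = (\<Sum>k\<in>K. r ^ G k \<iota>)" by (simp add: G_def)
  also have "\<dots> = (\<Sum>f\<in>G ` K. r ^ f \<iota>)" using inj by (simp add: sum.reindex)
  also have "\<dots> \<le> (\<Sum>f\<in>?P. r ^ f \<iota>)"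
  proof (rule sum_mono2[OF P_fin])
    show "G ` K \<subseteq> ?P" using order_trans[OF le] by (auto simp: G_def K_def)
  qed (use r in auto)
  also have "\<dots> = (\<Sum>f\<in>?P. \<Prod>i\<in>UNIV. if i = \<iota> then r ^ f i else 1)" by simp
  also have "\<dots> = (\<Prod>i\<in>(UNIV :: 'm set). \<Sum>a\<in>{..n}. if i = \<iota> then r ^ a else 1)"
    by (rule prod_sum_PiE[symmetric]) auto
  also have "\<dots> = (\<Sum>a\<le>n. r ^ a) * (\<Prod>i\<in>UNIV - {\<iota>}. real n + 1)"
    by (subst prod.remove[of _ \<iota>]) (auto simp: add.commute intro!: prod.cong)
  also have "\<dots> = (\<Sum>a\<le>n. r ^ a) * (real n + 1) ^ (CARD('m) - 1)" by (simp add: card_Diff_singleton)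
  also have "\<dots> \<le> r / (r - 1) * r ^ n * (real n + 1) ^ (CARD('m) - 1)"
  proof (intro mult_right_mono)
    have "(\<Sum>a\<le>n. r ^ a) = (r ^ Suc n - 1) / (r - 1)"
      using r geometric_sum[of r "Suc n"] by (simp add: lessThan_Suc_atMost)
    also have "\<dots> \<le> r ^ Suc n / (r - 1)" using r by (intro divide_right_mono) auto
    finally show "(\<Sum>a\<le>n. r ^ a) \<le> r / (r - 1) * r ^ n" by simp
  qed auto
  finally show "(\<Sum>k\<in>K. r ^ sum k UNIV) \<le> r / (r - 1) * r ^ n * (real n + 1) ^ (CARD('m) - 1)" .
qed

text \<open>With r = 2^(1/d) the summand is Z^(1 - 1/d) r^s, where s is the total. The geometric
  growth makes the top total dominate, and r^n \<le> Z^(1/d) restores the full power of Z.\<close>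

lemma sum_dyadic_le:
  fixes Z :: real and n d :: nat
  assumes Z: "1 \<le> Z" "2 ^ n \<le> Z" and d: "0 < d"
  shows "(\<Sum>k\<in>{k :: 'm::finite \<Rightarrow> nat. sum k UNIV \<le> n}. 2 ^ sum k UNIV * (Z / 2 ^ sum k UNIV) powr (1 - 1 / real d))
    \<le> 2 powr (1 / real d) / (2 powr (1 / real d) - 1) * Z * (real n + 1) ^ (CARD('m) - 1)"
proof -
  define r :: real where "r = 2 powr (1 / real d)"
  have r: "1 < r" using d by (simp add: r_def)
  have pow: "r ^ s = (2 ^ s) powr (1 / real d)" for s
    by (simp add: r_def powr_powr mult.commute flip: powr_realpow)
  have summand: "2 ^ s * (Z / 2 ^ s) powr (1 - 1 / real d) = Z powr (1 - 1 / real d) * r ^ s" for s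
  proof -
    have "(2 ^ s) powr (1 - 1 / real d) * r ^ s = (2 ^ s :: real)" unfolding pow by (simp flip: powr_add)
    moreover have "(Z / 2 ^ s) powr (1 - 1 / real d) = Z powr (1 - 1 / real d) / (2 ^ s) powr (1 - 1 / real d)"
      by (rule powr_divide)
    moreover have "(2 ^ s) powr (1 - 1 / real d) \<noteq> (0 :: real)" by simp
    ultimately show ?thesis by (metis mult.commute mult.left_commute nonzero_mult_div_cancel_left times_divide_eq_right)
  qed
  have "(\<Sum>k\<in>{k :: 'm \<Rightarrow> nat. sum k UNIV \<le> n}. 2 ^ sum k UNIV * (Z / 2 ^ sum k UNIV) powr (1 - 1 / real d))
    = Z powr (1 - 1 / real d) * (\<Sum>k\<in>{k :: 'm \<Rightarrow> nat. sum k UNIV \<le> n}. r ^ sum k UNIV)"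
    unfolding summand by (simp add: sum_distrib_left)
  also have "\<dots> \<le> Z powr (1 - 1 / real d) * (r / (r - 1) * r ^ n * (real n + 1) ^ (CARD('m) - 1))"
    by (intro mult_left_mono sum_power_total_le(3) r) auto
  also have "\<dots> \<le> Z powr (1 - 1 / real d) * (r / (r - 1) * Z powr (1 / real d) * (real n + 1) ^ (CARD('m) - 1))"
    using Z r unfolding pow by (intro mult_left_mono mult_right_mono powr_mono2) auto
  also have "\<dots> = r / (r - 1) * (Z powr (1 - 1 / real d) * Z powr (1 / real d)) * (real n + 1) ^ (CARD('m) - 1)"
    by (simp add: mult_ac)
  also have "Z powr (1 - 1 / real d) * Z powr (1 / real d) = Z" using Z by (simp flip: powr_add)
  finally show ?thesis unfolding r_def .
qed

text \<open>Vectors are grouped by the dyadic exponents k of their distances. A vector of class k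
  contributes at most 2^(M + \<bar>k\<bar>), with \<bar>k\<bar> the total, and
  \<open>card_near_le\<close> bounds the class with volume 2^(-\<bar>k\<bar>). \<Lambda> bounds the
  number of exponents available per row.\<close>

proposition S_L_le:
  fixes L :: "real^'n::finite^'m::finite"
  assumes Q: "\<And>j. 1 \<le> Q $ j" and \<delta>: "0 < \<delta>" "\<delta> \<le> 1"
    and bad: "\<And>q. q \<noteq> 0 \<Longrightarrow> (\<And>j. \<bar>real_of_int (q $ j)\<bar> \<le> Q $ j) \<Longrightarrow>
      \<delta> \<le> height_prod q * (\<Prod>i\<in>UNIV. dist_nearest_int (lin_form L i q))"
  defines "P \<equiv> \<Prod>j\<in>UNIV. Q $ j"
  defines "d \<equiv> CARD('n) + CARD('m)" and "\<Lambda> \<equiv> log 2 (P / \<delta>) + 1"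
  defines "A \<equiv> 2 ^ CARD('m) * ((2 * real d + 3) ^ CARD('n) * (8 * (real d + 1)) ^ CARD('m))"
    and "B \<equiv> 2 ^ CARD('m) * (real (d + 2) * 4 ^ d) * (2 powr (1 / real d) / (2 powr (1 / real d) - 1))"
  shows "S_L L Q \<le> A * (P * \<Lambda> ^ CARD('m)) + B * (P / \<delta> * \<Lambda> ^ (CARD('m) - 1))"
proof -
  define E where "E = (2 * real d + 3) ^ CARD('n) * (8 * (real d + 1)) ^ CARD('m)"
  define F where "F = real (d + 2) * 4 ^ d"
  define H where "H = 2 powr (1 / real d) / (2 powr (1 / real d) - 1)"
  define Z where "Z = P / \<delta>"
  define n where "n = nat \<lfloor>log 2 Z\<rfloor>"
  define K where "K = {k :: 'm \<Rightarrow> nat. sum k UNIV \<le> n}"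
  have Q0: "0 \<le> Q $ j" for j using Q[of j] by linarith
  have P1: "1 \<le> P" unfolding P_def using Q by (intro prod_ge_1)
  then have Z1: "1 \<le> Z" using \<delta> by (simp add: Z_def field_simps)
  have pow_le_iff: "s \<le> n \<longleftrightarrow> 2 ^ s \<le> Z" for s
  proof -
    have "s \<le> n \<longleftrightarrow> real s \<le> log 2 Z" using Z1 by (simp add: n_def le_nat_iff le_floor_iff)
    also have "\<dots> \<longleftrightarrow> 2 ^ s \<le> Z" using Z1 by (simp add: le_log_iff powr_realpow)
    finally show ?thesis .
  qed
  have n_le: "real n + 1 \<le> \<Lambda>"
    using Z1 by (simp add: n_def \<Lambda>_def flip: Z_def)
  have K_fin: "finite K" unfolding K_def by (rule sum_power_total_le(1)[of 2]) simp
  have box: "finite (int_box Q)"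
    by (rule finite_subset[OF _ card_int_box_le(1)[of "\<lambda>j. Q $ j"]]) (auto simp: int_box_def Q0)
  let ?D = "\<lambda>q i. dist_nearest_int (lin_form L i q)"
  \<comment> \<open>This lower bound keeps every distance positive, so that dyadic exponents exist,
    and limits their total to n.\<close>
  have prod_ge: "1 / Z \<le> prod (?D q) UNIV" if q: "q \<in> int_box Q" for q
  proof -
    have "\<delta> \<le> height_prod q * prod (?D q) UNIV" using q by (intro bad) (auto simp: int_box_def)
    also have "\<dots> \<le> P * prod (?D q) UNIV"
    proof (rule mult_right_mono)
      show "height_prod q \<le> P" unfolding height_prod_def P_def
        using q Q by (intro prod_mono) (auto simp: int_box_def)
      show "0 \<le> prod (?D q) UNIV" by (intro prod_nonneg) (simp add: dist_nearest_int_nonneg)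
    qed
    finally show ?thesis using P1 \<delta> by (simp add: Z_def field_simps)
  qed
  have D_pos: "0 < ?D q i" if q: "q \<in> int_box Q" for q i
  proof (rule ccontr)
    assume "\<not> 0 < ?D q i"
    then have "?D q i = 0" using dist_nearest_int_nonneg[of "lin_form L i q"] by linarith
    then have "prod (?D q) UNIV = 0" by (intro prod_zero) auto
    moreover have "0 < 1 / Z" using Z1 by simp
    ultimately show False using prod_ge[OF q] by linarith
  qed
  have "\<exists>k. (1 / 2) ^ Suc k < ?D q i \<and> ?D q i \<le> (1 / 2) ^ k" if q: "q \<in> int_box Q" for q i
    using D_pos[OF q] dist_nearest_int_le_half[of "lin_form L i q"] by (intro ex_dyadic_scale) auto
  then obtain \<kappa> where \<kappa>: "\<And>q i. q \<in> int_box Q \<Longrightarrow> (1 / 2) ^ Suc (\<kappa> q i) < ?D q i"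
      "\<And>q i. q \<in> int_box Q \<Longrightarrow> ?D q i \<le> (1 / 2) ^ \<kappa> q i"
    by metis
  have \<kappa>_K: "\<kappa> ` int_box Q \<subseteq> K"
  proof (rule image_subsetI)
    fix q assume q: "q \<in> int_box Q"
    have "1 / Z \<le> prod (?D q) UNIV" by (rule prod_ge[OF q])
    also have "\<dots> \<le> (\<Prod>i\<in>UNIV. (1 / 2) ^ \<kappa> q i)"
      using \<kappa>(2)[OF q] by (intro prod_mono) (auto simp: dist_nearest_int_nonneg)
    also have "\<dots> = 1 / 2 ^ sum (\<kappa> q) UNIV" unfolding power_sum[symmetric] by (simp add: power_one_over)
    finally have "2 ^ sum (\<kappa> q) UNIV \<le> Z" using Z1 by (simp add: field_simps)
    then show "\<kappa> q \<in> K" by (simp add: K_def pow_le_iff)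
  qed
  have inner: "(\<Sum>q\<in>{q \<in> int_box Q. \<kappa> q = k}. \<Prod>i\<in>UNIV. inverse (?D q i))
      \<le> 2 ^ CARD('m) * (E * P + F * (2 ^ sum k UNIV * (Z / 2 ^ sum k UNIV) powr (1 - 1 / real d)))"
    if k: "k \<in> K" for k
  proof -
    let ?s = "sum k UNIV" and ?X = "near L Q (\<lambda>_. 0) (\<lambda>i. (1 / 2) ^ k i)"
    have prod_k: "(\<Prod>i\<in>UNIV. (1 / 2) ^ k i) = 1 / (2 :: real) ^ ?s"
      unfolding power_sum[symmetric] by (simp add: power_one_over)
    have "2 ^ ?s \<le> Z" using k by (simp add: K_def pow_le_iff)
    then have W: "\<delta> \<le> P / 2 ^ ?s" using \<delta> by (simp add: Z_def field_simps)
    have "real (card ?X) \<le> E * (P / 2 ^ ?s) + F * (P / 2 ^ ?s / \<delta>) powr (1 - 1 / real d)"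
      unfolding E_def F_def d_def
      by (rule card_near_le[OF Q _ \<delta>(1) bad _ W]) (simp_all only: prod_k P_def, simp_all)
    also have "P / 2 ^ ?s / \<delta> = Z / 2 ^ ?s" by (simp add: Z_def)
    finally have cards: "real (card ?X) \<le> E * (P / 2 ^ ?s) + F * (Z / 2 ^ ?s) powr (1 - 1 / real d)" .
    have "(\<Sum>q\<in>{q \<in> int_box Q. \<kappa> q = k}. \<Prod>i\<in>UNIV. inverse (?D q i))
        \<le> (\<Sum>q\<in>{q \<in> int_box Q. \<kappa> q = k}. 2 ^ CARD('m) * 2 ^ ?s)"
    proof (rule sum_mono)
      fix q assume q: "q \<in> {q \<in> int_box Q. \<kappa> q = k}"
      have "inverse (?D q i) \<le> 2 * 2 ^ k i" for i
      proof -
        have "inverse (?D q i) \<le> inverse ((1 / 2) ^ Suc (k i))"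
          using \<kappa>(1)[of q i] q by (intro le_imp_inverse_le) auto
        then show ?thesis by (simp add: power_divide)
      qed
      then have "(\<Prod>i\<in>UNIV. inverse (?D q i)) \<le> (\<Prod>i\<in>UNIV. 2 * 2 ^ k i)"
        by (intro prod_mono) (auto simp: dist_nearest_int_nonneg)
      then show "(\<Prod>i\<in>UNIV. inverse (?D q i)) \<le> 2 ^ CARD('m) * 2 ^ ?s"
        by (simp add: prod.distrib power_sum)
    qed
    also have "\<dots> = real (card {q \<in> int_box Q. \<kappa> q = k}) * (2 ^ CARD('m) * 2 ^ ?s)" by simp
    also have "\<dots> \<le> real (card ?X) * (2 ^ CARD('m) * 2 ^ ?s)"
    proof -
      have "{q \<in> int_box Q. \<kappa> q = k} \<subseteq> ?X" using \<kappa>(2) by (auto simp: near_def int_box_def)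
      then have "card {q \<in> int_box Q. \<kappa> q = k} \<le> card ?X" by (intro card_mono finite_near Q0)
      then show ?thesis by (intro mult_right_mono) auto
    qed
    also have "\<dots> \<le> (E * (P / 2 ^ ?s) + F * (Z / 2 ^ ?s) powr (1 - 1 / real d)) * (2 ^ CARD('m) * 2 ^ ?s)"
      using cards by (intro mult_right_mono) auto
    \<comment> \<open>The weight 2^s cancels the volume in the first term. What remains is the same
      for every class, so that term costs the full number of classes, one logarithm per row.\<close>
    also have "\<dots> = 2 ^ CARD('m) * (E * P + F * (2 ^ ?s * (Z / 2 ^ ?s) powr (1 - 1 / real d)))"
      by (simp add: algebra_simps)
    finally show ?thesis .
  qed
  have "1 \<le> (2 :: real) powr (1 / real d)" by (rule ge_one_powr_ge_zero) auto
  then have EFH: "0 \<le> E" "0 \<le> F" "0 \<le> H"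
    unfolding E_def F_def H_def by (auto intro!: divide_nonneg_nonneg)
  have "S_L L Q = (\<Sum>k\<in>K. \<Sum>q\<in>{q \<in> int_box Q. \<kappa> q = k}. \<Prod>i\<in>UNIV. inverse (?D q i))"
    unfolding S_L_def by (rule sum.group[OF box K_fin \<kappa>_K, symmetric])
  also have "\<dots> \<le> (\<Sum>k\<in>K. 2 ^ CARD('m) * (E * P + F * (2 ^ sum k UNIV * (Z / 2 ^ sum k UNIV) powr (1 - 1 / real d))))"
    using inner by (rule sum_mono)
  also have "\<dots> = 2 ^ CARD('m) * (E * P * real (card K)
      + F * (\<Sum>k\<in>K. 2 ^ sum k UNIV * (Z / 2 ^ sum k UNIV) powr (1 - 1 / real d)))"
    by (simp add: sum.distrib flip: sum_distrib_left)
  also have "\<dots> \<le> 2 ^ CARD('m) * (E * P * \<Lambda> ^ CARD('m) + F * (H * Z * \<Lambda> ^ (CARD('m) - 1)))"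
  proof (intro mult_left_mono add_mono)
    have "real (card K) \<le> (real n + 1) ^ CARD('m)"
      unfolding K_def by (rule sum_power_total_le(2)[of 2]) simp
    also have "\<dots> \<le> \<Lambda> ^ CARD('m)" using n_le by (intro power_mono) auto
    finally show "real (card K) \<le> \<Lambda> ^ CARD('m)" .
    have "(\<Sum>k\<in>K. 2 ^ sum k UNIV * (Z / 2 ^ sum k UNIV) powr (1 - 1 / real d)) \<le> H * Z * (real n + 1) ^ (CARD('m) - 1)"
      unfolding K_def H_def using Z1 pow_le_iff[of n] by (intro sum_dyadic_le) (auto simp: d_def)
    also have "\<dots> \<le> H * Z * \<Lambda> ^ (CARD('m) - 1)"
      using n_le EFH Z1 by (intro mult_left_mono power_mono) auto
    finally show "(\<Sum>k\<in>K. 2 ^ sum k UNIV * (Z / 2 ^ sum k UNIV) powr (1 - 1 / real d)) \<le> H * Z * \<Lambda> ^ (CARD('m) - 1)" .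
  qed (use EFH P1 in auto)
  also have "\<dots> = A * (P * \<Lambda> ^ CARD('m)) + B * (P / \<delta> * \<Lambda> ^ (CARD('m) - 1))"
    unfolding A_def B_def E_def[symmetric] F_def[symmetric] H_def[symmetric] Z_def[symmetric]
    by (simp only: distrib_left mult_ac)
  finally show ?thesis .
qed

section \<open>Specialisation to \<delta> = \<phi>(Q) and comparison of logarithms\<close>

theorem theorem1p3:
  "\<exists>c>0. \<forall>(\<phi>::real \<Rightarrow> real) (L::real^'n::finite^'m::finite) (Q::real^'n).
     (\<forall>x\<ge>0. 0 < \<phi> x \<and> \<phi> x \<le> 1) \<longrightarrow>
     (\<forall>x y. 0 \<le> x \<longrightarrow> x < y \<longrightarrow> \<phi> y \<le> \<phi> x) \<longrightarrow>
     (\<forall>i. lin_indep_with_one_over_Q (L $ i)) \<longrightarrow>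
     mult_badly_approx \<phi> L \<longrightarrow>
     (\<forall>j. 1 \<le> Q $ j) \<longrightarrow>
     (let Qg = (\<Prod>j\<in>UNIV. Q $ j) powr (1 / real CARD('n)) in
       2 \<le> Qg \<longrightarrow>
       S_L L Q \<le> c * (Qg ^ CARD('n) * ln (Qg / \<phi> Qg) ^ CARD('m)
                      + Qg ^ CARD('n) / \<phi> Qg * ln (Qg / \<phi> Qg) ^ (CARD('m) - 1)))"
proof -
  define d where "d = CARD('n) + CARD('m)"
  define A where "A = 2 ^ CARD('m) * ((2 * real d + 3) ^ CARD('n) * (8 * (real d + 1)) ^ CARD('m))"
  define B where "B = 2 ^ CARD('m) * (real (d + 2) * 4 ^ d) * (2 powr (1 / real d) / (2 powr (1 / real d) - 1))"
  \<comment> \<open>D converts \<Lambda> into a multiple of l = ln (Qg / \<delta>): ln (P /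
    \<delta>) \<le> N l, and the extra 1 in \<Lambda> is at most l / ln 2 since Qg / \<delta> \<ge>
    2. As D \<ge> 1, the power D^M serves for both terms.\<close>
  define D where "D = (real CARD('n) + 1) / ln 2"
  define c where "c = (A + B) * D ^ CARD('m)"
  have "1 \<le> D" using ln2_le_25_over_36 by (simp add: D_def)
  have "0 < A" by (simp add: A_def add_nonneg_pos)
  have "1 \<le> (2 :: real) powr (1 / real d)" by (rule ge_one_powr_ge_zero) auto
  then have "0 \<le> B" unfolding B_def by (intro mult_nonneg_nonneg divide_nonneg_nonneg) auto
  have "0 < c" using \<open>0 < A\<close> \<open>0 \<le> B\<close> \<open>1 \<le> D\<close> by (simp add: c_def)
  moreover have "S_L L Q \<le> c * (Qg ^ CARD('n) * ln (Qg / \<phi> Qg) ^ CARD('m)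
      + Qg ^ CARD('n) / \<phi> Qg * ln (Qg / \<phi> Qg) ^ (CARD('m) - 1))"
    if \<phi>: "\<And>x. 0 \<le> x \<Longrightarrow> 0 < \<phi> x \<and> \<phi> x \<le> 1" and mono: "\<And>x y. 0 \<le> x \<Longrightarrow> x < y \<Longrightarrow> \<phi> y \<le> \<phi> x"
      and bad: "mult_badly_approx \<phi> L" and Q: "\<And>j. 1 \<le> Q $ j"
      and Qg: "Qg = (\<Prod>j\<in>UNIV. Q $ j) powr (1 / real CARD('n))" "2 \<le> Qg"
    for \<phi> and L :: "real^'n^'m" and Q :: "real^'n" and Qg
  proof -
    define P where "P = (\<Prod>j\<in>UNIV. Q $ j)"
    have P1: "1 \<le> P" unfolding P_def using Q by (intro prod_ge_1)
    then have P: "Qg ^ CARD('n) = P"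
      using Qg(2) by (simp add: Qg(1) powr_powr flip: powr_realpow P_def)
    define \<delta> where "\<delta> = \<phi> Qg"
    have \<delta>: "0 < \<delta>" "\<delta> \<le> 1" using \<phi>[of Qg] Qg(2) by (auto simp: \<delta>_def)
    define l where "l = ln (Qg / \<delta>)"
    define \<Lambda> where "\<Lambda> = log 2 (P / \<delta>) + 1"
    have "2 \<le> Qg / \<delta>" using \<delta> Qg(2) by (simp add: field_simps)
    then have l: "ln 2 \<le> l" by (simp add: l_def)
    then have l0: "0 < l" using ln_gt_zero[of "2::real"] by linarith
    have "ln (P / \<delta>) \<le> real CARD('n) * l"
    proof -
      \<comment> \<open>Since \<delta> \<le> 1, replacing \<delta> by \<delta>^N only enlarges the
        quotient and makes it an N-th power.\<close>
      have "P / \<delta> \<le> Qg ^ CARD('n) / \<delta> ^ CARD('n)"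
        using P P1 \<delta> power_decreasing[of 1 "CARD('n)" \<delta>] by (intro frac_le) auto
      then have "ln (P / \<delta>) \<le> ln ((Qg / \<delta>) ^ CARD('n))"
        using P1 \<delta> unfolding power_divide by (intro ln_mono) auto
      then show ?thesis using \<delta> Qg(2) by (simp add: ln_realpow l_def)
    qed
    then have "\<Lambda> \<le> real CARD('n) * l / ln 2 + l / ln 2"
      unfolding \<Lambda>_def log_def using l by (intro add_mono divide_right_mono) auto
    then have \<Lambda>_le: "\<Lambda> \<le> D * l" by (simp add: D_def field_simps)
    have "1 \<le> P / \<delta>" using P1 \<delta> by (simp add: field_simps)
    then have \<Lambda>0: "0 \<le> \<Lambda>" by (simp add: \<Lambda>_def)
    have D_pow: "\<Lambda> ^ m \<le> D ^ CARD('m) * l ^ m" if "m \<le> CARD('m)" for m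
    proof -
      have "\<Lambda> ^ m \<le> (D * l) ^ m" using \<Lambda>_le \<Lambda>0 by (rule power_mono)
      also have "\<dots> = D ^ m * l ^ m" by (rule power_mult_distrib)
      also have "\<dots> \<le> D ^ CARD('m) * l ^ m"
        using that \<open>1 \<le> D\<close> l0 by (intro mult_right_mono power_increasing) auto
      finally show ?thesis .
    qed
    have "S_L L Q \<le> A * (P * \<Lambda> ^ CARD('m)) + B * (P / \<delta> * \<Lambda> ^ (CARD('m) - 1))"
      unfolding A_def B_def \<Lambda>_def P_def d_def
    proof (rule S_L_le[OF Q \<delta>])
      fix q :: "int^'n" assume q: "q \<noteq> 0" "\<And>j. \<bar>real_of_int (q $ j)\<bar> \<le> Q $ j"
      have "0 \<le> height_prod q" unfolding height_prod_def by (intro prod_nonneg) auto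
      moreover have "height_prod q \<le> P" unfolding height_prod_def P_def
        using q Q by (intro prod_mono) auto
      \<comment> \<open>In the box the height is at most P, so the argument of \<phi> is at most Qg,
        and monotonicity replaces \<phi> by the single constant \<delta>.\<close>
      ultimately have "height_prod q powr (1 / real CARD('n)) \<le> Qg"
        unfolding Qg(1) P_def[symmetric] by (intro powr_mono2) auto
      then have "\<delta> \<le> \<phi> (height_prod q powr (1 / real CARD('n)))"
        unfolding \<delta>_def using mono[of "height_prod q powr (1 / real CARD('n))" Qg] by fastforce
      also have "\<dots> \<le> height_prod q * (\<Prod>i\<in>UNIV. dist_nearest_int (lin_form L i q))"
        using bad q(1) by (simp add: mult_badly_approx_def)
      finally show "\<delta> \<le> height_prod q * (\<Prod>i\<in>UNIV. dist_nearest_int (lin_form L i q))" .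
    qed
    also have "\<dots> \<le> A * (P * (D ^ CARD('m) * l ^ CARD('m))) + B * (P / \<delta> * (D ^ CARD('m) * l ^ (CARD('m) - 1)))"
      using \<open>0 < A\<close> \<open>0 \<le> B\<close> P1 \<delta> by (intro add_mono mult_left_mono D_pow) auto
    also have "\<dots> \<le> (A + B) * (P * (D ^ CARD('m) * l ^ CARD('m))) + (A + B) * (P / \<delta> * (D ^ CARD('m) * l ^ (CARD('m) - 1)))"
      using \<open>0 < A\<close> \<open>0 \<le> B\<close> \<open>1 \<le> D\<close> P1 \<delta> l0 by (intro add_mono mult_right_mono) auto
    also have "\<dots> = c * (P * l ^ CARD('m) + P / \<delta> * l ^ (CARD('m) - 1))"
      unfolding c_def by (simp only: distrib_left mult_ac)
    finally show ?thesis unfolding P l_def \<delta>_def .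
  qed
  ultimately show ?thesis unfolding Let_def by (intro exI[of _ c]) blast
qed

end
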